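(* Consider an $N$-player game over simplexes with costs $f_1,\dots,f_N:\Delta^N\to\mathbb{R}$ whose pseudo-gradient operator $F$ is monotone and $L$-Lipschitz ($L>0$), and let $\tau>0$. Let $z^\star=(g_i^\star)_{i=1}^N$ be the unique Nash equilibrium of the entropy-regularized game in which player $i$ minimizes $f_i(g_i,g_{-i})-\tau\mathcal H(g_i)$ over $g_i\in\Delta$. Let $$0<\eta<\frac{1}{2(N+4)L+2\tau},$$ and let the iterates be generated, from $\theta_i^0=\bar\theta_i^0=0\in\mathbb{R}^n$ for all $i\in\{1,\dots,N\}$, by $$\bar\theta_i^{t+1}=(1-\eta\tau)\theta_i^t-\eta\nabla_{g_i}f_i(g_{\bar\theta_i^t},g_{\bar\theta_{-i}^t}),\qquad \theta_i^{t+1}=(1-\eta\tau)\theta_i^t-\eta\nabla_{g_i}f_i(g_{\bar\theta_i^{t+1}},g_{\bar\theta_{-i}^{t+1}}).$$ Write $z_t=(g_{\theta_i^t})_{i=1}^N$, $\bar z_t=(g_{\bar\theta_i^t})_{i=1}^N$, $\theta_t=(\theta_i^t)_{i=1}^N$, and $\theta^\star=(\theta_i^\star)_{i=1}^N$ with $\theta_i^\star=-\frac{1}{\tau}\nabla_{g_i}f_i(g_i^\star,g_{-i}^\star)$. Then for all $t\ge0$, $$\max\{\mathrm{KL}(z^\star\|z_t),\mathrm{KL}(z^\star\|\bar z_{t+1})\}\le(1-\eta\tau)^t\,2\,\mathrm{KL}(z^\star\|z_0),$$ $$\|\theta_{t+1}-\theta^\star\|^2\le\Big(1-\frac{\eta\tau}{2}\Big)^tV_0,$$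 where $V_0=\|\theta_0-\theta^\star\|^2+\frac{2NC}{\eta\tau}$ and $C=4\eta^2L^2\Big(1+\frac{1}{\eta\tau}(1-\eta\tau)^2\Big)\mathrm{KL}(z^\star\|z_0)$.
   Context: $\Delta$ is the probability simplex in $\mathbb{R}^n$ (each of the $N$ players has $n$ actions). A strategy profile is $z=(g_1,\dots,g_N)\in\Delta^N$; $g_{-i}$ denotes the strategies of all players other than $i$. The costs $f_i$ are continuously differentiable and $F(z)=[\nabla_{g_i}f_i(g_i,g_{-i})]_{i=1}^N\in\mathbb{R}^{nN}$. Monotone: $\langle F(z)-F(z'),z-z'\rangle\ge0$; $L$-Lipschitz: $\|F(z)-F(z')\|\le L\|z-z'\|$, for all $z,z'\in\Delta^N$. $\mathcal H(\pi)=-\sum_a\pi(a)\log\pi(a)$. For $\theta\in\mathbb{R}^n$, $g_\theta(a)=e^{\theta(a)}/\sum_{a'}e^{\theta(a')}$ (softmax). For profiles, $\mathrm{KL}(z\|z')=\sum_i\mathrm{KL}(g_i\|g_i')$; $\|\cdot\|$ is the Euclidean norm. The regularized game has a unique Nash equilibrium in $\Delta^N$. *)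

theory Defs
  imports "HOL-Analysis.Analysis"
begin

(* Players are indexed by the finite type 'p (N = CARD('p)) and actions by the finite type 'n
   (n = CARD('n)).  The norm and inner product of the type real^'n^'p are the Euclidean ones of
   the concatenated vector in R^(nN). *)

definition simplex_set :: "(real^'n) set" where
  "simplex_set = {g. (\<forall>a. 0 \<le> g $ a) \<and> (\<Sum>a\<in>UNIV. g $ a) = 1}"

definition profiles :: "(real^'n^'p) set" where
  "profiles = {z. \<forall>i. z $ i \<in> simplex_set}"

definition deviate :: "real^'n^'p \<Rightarrow> 'p \<Rightarrow> real^'n \<Rightarrow> real^'n^'p" where
  "deviate z i g = (\<chi> j. if j = i then g else z $ j)"

definition C1_on :: "('e::euclidean_space \<Rightarrow> real) \<Rightarrow> 'e set \<Rightarrow> bool" where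
  "C1_on h U \<longleftrightarrow> (\<exists>G. continuous_on U G \<and> (\<forall>x\<in>U. GDERIV h x :> G x))"

(* The simplex has empty interior in R^n, so the gradients in R^n presuppose costs that are
   continuously differentiable on a neighbourhood of the set of profiles.  Values of the costs
   outside U are irrelevant. *)
definition smooth_costs :: "('p \<Rightarrow> real^'n^'p \<Rightarrow> real) \<Rightarrow> bool" where
  "smooth_costs f \<longleftrightarrow> (\<exists>U. open U \<and> profiles \<subseteq> U \<and> (\<forall>i. C1_on (f i) U))"

(* The gradient of f_i in player i's own strategy; it is unique wherever it exists. *)
definition own_grad :: "('p \<Rightarrow> real^'n^'p \<Rightarrow> real) \<Rightarrow> 'p \<Rightarrow> real^'n^'p \<Rightarrow> real^'n" where
  "own_grad f i z = (THE D. GDERIV (\<lambda>g. f i (deviate z i g)) (z $ i) :> D)"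

definition pseudo_gradient :: "('p \<Rightarrow> real^'n^'p \<Rightarrow> real) \<Rightarrow> real^'n^'p \<Rightarrow> real^'n^'p" where
  "pseudo_gradient f z = (\<chi> i. own_grad f i z)"

definition monotone_operator_on :: "'e::real_inner set \<Rightarrow> ('e \<Rightarrow> 'e) \<Rightarrow> bool" where
  "monotone_operator_on S F \<longleftrightarrow> (\<forall>z\<in>S. \<forall>z'\<in>S. 0 \<le> (F z - F z') \<bullet> (z - z'))"

(* The convention 0 log 0 = 0 holds because the factor 0 annihilates ln 0. *)
definition shannon_entropy :: "real^'n \<Rightarrow> real" where
  "shannon_entropy g = - (\<Sum>a\<in>UNIV. g $ a * ln (g $ a))"

definition reg_nash :: "('p \<Rightarrow> real^'n^'p \<Rightarrow> real) \<Rightarrow> real \<Rightarrow> real^'n^'p \<Rightarrow> bool" where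
  "reg_nash f \<tau> z \<longleftrightarrow> z \<in> profiles \<and>
     (\<forall>i. \<forall>g\<in>simplex_set.
        f i z - \<tau> * shannon_entropy (z $ i) \<le> f i (deviate z i g) - \<tau> * shannon_entropy g)"

definition softmax :: "real^'n \<Rightarrow> real^'n" where
  "softmax \<theta> = (\<chi> a. exp (\<theta> $ a) / (\<Sum>b\<in>UNIV. exp (\<theta> $ b)))"

definition softmax_profile :: "real^'n^'p \<Rightarrow> real^'n^'p" where
  "softmax_profile \<theta> = (\<chi> i. softmax (\<theta> $ i))"

(* Terms with g $ a = 0 vanish, as usual.  The formula is the Kullback-Leibler divergence only
   if h $ a = 0 implies g $ a = 0 (otherwise the divergence is infinite, whereas division by
   zero makes the term 0 here); it is only used with a softmax as second argument, which has
   positive entries. *)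
definition KL :: "real^'n \<Rightarrow> real^'n \<Rightarrow> real" where
  "KL g h = (\<Sum>a\<in>UNIV. g $ a * ln (g $ a / h $ a))"

definition KL_profile :: "real^'n^'p \<Rightarrow> real^'n^'p \<Rightarrow> real" where
  "KL_profile z z' = (\<Sum>i\<in>UNIV. KL (z $ i) (z' $ i))"

end

theory Submission
  imports Defs
begin

text \<open>
  Why the theorem is true.  The first-order condition of the regularized equilibrium says that
  \<open>z\<^sup>\<star>\<close> is the softmax of \<open>\<theta>\<^sup>\<star>\<close>, so \<open>\<theta>\<^sup>\<star>\<close> is the fixed point of both updates, and in parameter
  space the algorithm is an optimistic gradient step contracting towards \<open>\<theta>\<^sup>\<star>\<close>.  As long as the
  second argument is a softmax, the divergence \<open>KL p (softmax \<theta>)\<close> is affine in \<open>\<theta>\<close> up to a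
  log-partition term that does not depend on \<open>p\<close>.  Pairing the update with \<open>zbar (Suc t) - z\<^sup>\<star>\<close>
  therefore turns monotonicity of the pseudo-gradient into a recursion for \<open>KL z\<^sup>\<star> (z t)\<close> with
  factor \<open>1 - \<eta>\<tau>\<close>, whose only error term is the inner product of the difference of two consecutive
  gradients with \<open>zbar (Suc t) - z (Suc t)\<close>.

  This error is absorbed by the Lipschitz bound and by the strong convexity of the negative
  entropy, \<open>\<parallel>p - q\<parallel>\<^sup>2 / 2 \<le> KL p q\<close> (lemma \<open>KL_profile_ge_norm\<close>), because the recursion also carries
  negative divergences between \<open>zbar (Suc t)\<close> and its two neighbours.  The quantity that decreases is
  \<open>KL z\<^sup>\<star> (z t) + (1 - 2\<eta>L) KL (z t) (zbar t)\<close>, whose second part vanishes at \<open>t = 0\<close>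
  (lemma \<open>optimistic_step\<close>).  One more three-point expansion transfers the bound to
  \<open>zbar (Suc t)\<close> at the price of a factor 2 (lemma \<open>optimistic_midpoint\<close>).

  The bound on the parameters follows: \<open>\<theta> (Suc t) - \<theta>\<^sup>\<star>\<close> is \<open>(1 - \<eta>\<tau>)(\<theta> t - \<theta>\<^sup>\<star>)\<close> plus a
  gradient difference that is already known to decay geometrically, so Young's inequality and the
  linear recursion of lemma \<open>perturbed_contraction\<close> finish the proof.
\<close>

section \<open>Entropy and divergence at softmax strategies\<close>

text \<open>
  On the unit interval \<open>x ln x\<close> has second derivative \<open>1/x \<ge> 1\<close>, so it stays above its tangent by
  half the squared distance.  Summed over the actions this is already the Euclidean form of
  Pinsker's inequality, with no detour through the 1-norm.
\<close>
lemma xlnx_above_tangent: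
  fixes x y :: real
  assumes "0 \<le> x" "x \<le> 1" "0 < y" "y \<le> 1"
  shows "(x - y)\<^sup>2 / 2 \<le> x * ln x - x * ln y - x + y"
proof (cases "x = 0")
  case True
  have "y * y \<le> 1 * y" using assms by (intro mult_right_mono) auto
  then show ?thesis using True assms by (simp add: power2_eq_square)
next
  case False
  have "(ln y + 1 - y) * (x - y) \<le> (x * ln x - x\<^sup>2 / 2) - (y * ln y - y\<^sup>2 / 2)"
  proof (rule f''_imp_f'[where C = "{0<..1}" and f'' = "\<lambda>x. 1 / x - 1"])
    show "convex {0<..1::real}" by simp
    show "((\<lambda>x. x * ln x - x\<^sup>2 / 2) has_real_derivative ln x + 1 - x) (at x)"
      if "x \<in> {0<..1}" for x :: real
      using that by (auto intro!: derivative_eq_intros)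
    show "((\<lambda>x. ln x + 1 - x) has_real_derivative 1 / x - 1) (at x)"
      if "x \<in> {0<..1}" for x :: real
      using that by (auto intro!: derivative_eq_intros)
  qed (use assms False in \<open>auto simp: field_simps\<close>)
  then show ?thesis by (simp add: power2_eq_square algebra_simps field_simps)
qed

lemma simplex_le_1:
  fixes g :: "real^'n::finite"
  assumes "g \<in> simplex_set"
  shows "g $ a \<le> 1"
proof -
  have "g $ a \<le> (\<Sum>a\<in>UNIV. g $ a)"
    using assms by (intro member_le_sum) (auto simp: simplex_set_def)
  then show ?thesis using assms by (simp add: simplex_set_def)
qed

lemma KL_ge_norm:
  fixes g h :: "real^'n::finite"
  assumes g: "g \<in> simplex_set" and h: "h \<in> simplex_set" and pos: "\<And>a. 0 < h $ a"
  shows "(norm (g - h))\<^sup>2 / 2 \<le> KL g h"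
proof -
  have "(norm (g - h))\<^sup>2 / 2 = (\<Sum>a\<in>UNIV. (g $ a - h $ a)\<^sup>2 / 2)"
    unfolding power2_norm_eq_inner
    by (simp add: inner_vec_def power2_eq_square sum_divide_distrib)
  also have "\<dots> \<le> (\<Sum>a\<in>UNIV. g $ a * ln (g $ a / h $ a) - g $ a + h $ a)"
  proof (rule sum_mono)
    fix a
    have "g $ a * ln (g $ a / h $ a) = g $ a * ln (g $ a) - g $ a * ln (h $ a)"
      using g pos[of a] by (cases "g $ a = 0")
        (auto simp: simplex_set_def ln_div algebra_simps less_le)
    then show "(g $ a - h $ a)\<^sup>2 / 2 \<le> g $ a * ln (g $ a / h $ a) - g $ a + h $ a"
      using xlnx_above_tangent[of "g $ a" "h $ a"] g pos[of a] simplex_le_1[OF g] simplex_le_1[OF h]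
      by (auto simp: simplex_set_def)
  qed
  also have "\<dots> = KL g h"
    using g h by (simp add: KL_def simplex_set_def sum.distrib sum_subtractf)
  finally show ?thesis .
qed

text \<open>
  Log-sum-exp, the normalization constant in \<open>ln (softmax \<theta>) = \<theta> - log_partition \<theta>\<close>.
\<close>
definition log_partition :: "real^'n::finite \<Rightarrow> real" where
  "log_partition \<theta> = ln (\<Sum>b\<in>UNIV. exp (\<theta> $ b))"

lemma sum_exp_pos: "0 < (\<Sum>b\<in>UNIV. exp ((\<theta> :: real^'n::finite) $ b))"
  by (intro sum_pos) auto

lemma softmax_pos: "0 < softmax (\<theta> :: real^'n::finite) $ a"
  using sum_exp_pos[of \<theta>] by (simp add: softmax_def)

lemma softmax_in_simplex: "softmax (\<theta> :: real^'n::finite) \<in> simplex_set"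
  using sum_exp_pos[of \<theta>] softmax_pos[of \<theta>]
  by (auto simp: simplex_set_def less_imp_le)
     (simp add: softmax_def flip: sum_divide_distrib)

lemma ln_softmax: "ln (softmax \<theta> $ a) = \<theta> $ a - log_partition (\<theta> :: real^'n::finite)"
  using sum_exp_pos[of \<theta>] by (simp add: softmax_def log_partition_def ln_div)

lemma KL_softmax:
  fixes g \<theta> :: "real^'n::finite"
  assumes "g \<in> simplex_set"
  shows "KL g (softmax \<theta>) = - shannon_entropy g - g \<bullet> \<theta> + log_partition \<theta>"
proof -
  have "KL g (softmax \<theta>)
      = (\<Sum>a\<in>UNIV. g $ a * ln (g $ a) - g $ a * \<theta> $ a + g $ a * log_partition \<theta>)"
    unfolding KL_def
  proof (rule sum.cong)
    fix a
    show "g $ a * ln (g $ a / softmax \<theta> $ a)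
        = g $ a * ln (g $ a) - g $ a * \<theta> $ a + g $ a * log_partition \<theta>"
      using assms softmax_pos[of \<theta> a] by (cases "g $ a = 0")
        (auto simp: simplex_set_def ln_div ln_softmax algebra_simps less_le)
  qed simp
  also have "\<dots> = - shannon_entropy g - g \<bullet> \<theta> + log_partition \<theta>"
    using assms by (simp add: shannon_entropy_def inner_vec_def sum.distrib sum_subtractf
        simplex_set_def flip: sum_distrib_right)
  finally show ?thesis .
qed

lemma softmax_profile_in_profiles: "softmax_profile \<theta> \<in> profiles"
  by (simp add: softmax_profile_def profiles_def softmax_in_simplex)

lemma KL_profile_ge_norm:
  fixes z \<theta> :: "real^'n::finite^'p::finite"
  assumes "z \<in> profiles"
  shows "(norm (z - softmax_profile \<theta>))\<^sup>2 / 2 \<le> KL_profile z (softmax_profile \<theta>)"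
proof -
  have "(norm (z - softmax_profile \<theta>))\<^sup>2 / 2 = (\<Sum>i\<in>UNIV. (norm (z $ i - softmax (\<theta> $ i)))\<^sup>2 / 2)"
    unfolding power2_norm_eq_inner
    by (simp add: inner_vec_def[of "_ :: real^'n^'p"] softmax_profile_def sum_divide_distrib)
  also have "\<dots> \<le> (\<Sum>i\<in>UNIV. KL (z $ i) (softmax (\<theta> $ i)))"
    using assms by (intro sum_mono KL_ge_norm softmax_in_simplex softmax_pos)
      (auto simp: profiles_def)
  finally show ?thesis by (simp add: KL_profile_def softmax_profile_def)
qed

lemma KL_profile_nonneg:
  assumes "z \<in> profiles"
  shows "0 \<le> KL_profile z (softmax_profile \<theta>)"
  using KL_profile_ge_norm[OF assms, of \<theta>] by (smt (verit) zero_le_power2 divide_nonneg_nonneg)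

text \<open>
  The parameter enters the divergence linearly, up to a term that does not involve the first
  argument; all divergence identities below are linear algebra on top of this formula.
\<close>
lemma KL_profile_softmax:
  fixes z \<theta> :: "real^'n::finite^'p::finite"
  assumes "z \<in> profiles"
  shows "KL_profile z (softmax_profile \<theta>)
    = - (\<Sum>i\<in>UNIV. shannon_entropy (z $ i)) - z \<bullet> \<theta> + (\<Sum>i\<in>UNIV. log_partition (\<theta> $ i))"
  using assms
  by (simp add: KL_profile_def softmax_profile_def KL_softmax profiles_def sum.distrib
      sum_subtractf sum_negf inner_vec_def[of z])

lemma KL_profile_self: "KL_profile (softmax_profile \<theta>) (softmax_profile \<theta>) = 0"
proof -
  have "softmax (\<theta> $ i) $ a \<noteq> 0" for i a
    using softmax_pos[of "\<theta> $ i" a] by simp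
  then show ?thesis by (simp add: KL_profile_def KL_def softmax_profile_def)
qed

text \<open>The three-point identity of the Bregman divergence of the negative entropy.\<close>
lemma KL_three_point:
  assumes "z \<in> profiles"
  shows "KL_profile z (softmax_profile \<beta>)
    = KL_profile z (softmax_profile \<alpha>) + KL_profile (softmax_profile \<alpha>) (softmax_profile \<beta>)
      + (z - softmax_profile \<alpha>) \<bullet> (\<alpha> - \<beta>)"
  using KL_profile_self[of \<alpha>]
  unfolding KL_profile_softmax[OF assms] KL_profile_softmax[OF softmax_profile_in_profiles]
  by (simp add: inner_simps)

section \<open>The regularized equilibrium as a softmax\<close>

text \<open>
  \<open>x ln x\<close> is convex: add the tangent bounds at the intermediate point with weights \<open>1 - s\<close>
  and \<open>s\<close>.  Positivity of \<open>h\<close> keeps that point away from 0.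
\<close>
lemma shannon_entropy_concave:
  fixes g h :: "real^'n::finite"
  assumes g: "g \<in> simplex_set" and h: "h \<in> simplex_set" and pos: "\<And>a. 0 < h $ a"
    and s: "0 < s" "s < 1"
  shows "(1 - s) * shannon_entropy g + s * shannon_entropy h
    \<le> shannon_entropy (g + s *\<^sub>R (h - g))"
proof -
  have "(g + s *\<^sub>R (h - g)) $ a * ln ((g + s *\<^sub>R (h - g)) $ a)
      \<le> (1 - s) * (g $ a * ln (g $ a)) + s * (h $ a * ln (h $ a))" for a
  proof -
    define x y w where "x = g $ a" and "y = h $ a" and "w = (1 - s) * x + s * y"
    have x: "0 \<le> x" "x \<le> 1" using g simplex_le_1[OF g] by (auto simp: x_def simplex_set_def)
    have y: "0 < y" "y \<le> 1" using simplex_le_1[OF h] pos by (auto simp: y_def)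
    have w0: "0 < w" unfolding w_def using x y s by (intro add_nonneg_pos) auto
    have "w \<le> (1 - s) * 1 + s * 1"
      unfolding w_def using x y s by (intro add_mono mult_left_mono) auto
    then have w: "0 < w" "w \<le> 1" using w0 by auto
    have tangent: "0 \<le> v * ln v - v * ln w - v + w" if "0 \<le> v" "v \<le> 1" for v
      using xlnx_above_tangent[OF that w] by (smt (verit) zero_le_power2 divide_nonneg_nonneg)
    have "0 \<le> (1 - s) * (x * ln x - x * ln w - x + w) + s * (y * ln y - y * ln w - y + w)"
      using mult_nonneg_nonneg[OF _ tangent[of x], of "1 - s"]
        mult_nonneg_nonneg[OF _ tangent[of y], of s] x y s by simp
    also have "\<dots> = (1 - s) * (x * ln x) + s * (y * ln y) - w * ln w"
      unfolding w_def by (simp add: algebra_simps)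
    finally have "w * ln w \<le> (1 - s) * (x * ln x) + s * (y * ln y)" by simp
    moreover have "(g + s *\<^sub>R (h - g)) $ a = w"
      by (simp add: w_def x_def y_def algebra_simps)
    ultimately show ?thesis by (simp add: x_def y_def)
  qed
  then have "(\<Sum>a\<in>UNIV. (g + s *\<^sub>R (h - g)) $ a * ln ((g + s *\<^sub>R (h - g)) $ a))
      \<le> (\<Sum>a\<in>UNIV. (1 - s) * (g $ a * ln (g $ a)) + s * (h $ a * ln (h $ a)))"
    by (rule sum_mono)
  then show ?thesis
    by (simp add: shannon_entropy_def sum.distrib flip: sum_distrib_left)
qed

text \<open>
  As \<open>own_grad\<close> is a definite description, it has to be identified with the \<open>i\<close>-th block of the full
  gradient, which exists by smoothness.
\<close>
lemma GDERIV_own_grad: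
  fixes f :: "'p::finite \<Rightarrow> real^'n::finite^'p \<Rightarrow> real"
  assumes "smooth_costs f" "z \<in> profiles"
  shows "GDERIV (\<lambda>g. f i (deviate z i g)) (z $ i) :> own_grad f i z"
proof -
  obtain G where "GDERIV (f i) z :> G"
    using assms unfolding smooth_costs_def C1_on_def by blast
  moreover have "deviate z i (z $ i) = z"
    by (simp add: deviate_def vec_eq_iff)
  ultimately have f: "(f i has_derivative (\<lambda>h. h \<bullet> G)) (at (deviate z i (z $ i)))"
    by (simp add: gderiv_def)
  have affine: "deviate z i = (\<lambda>g. deviate z i 0 + deviate 0 i g)"
    by (simp add: deviate_def vec_eq_iff fun_eq_iff)
  have lin: "linear (deviate (0 :: real^'n^'p) i)"
    by (rule linearI) (auto simp: deviate_def vec_eq_iff)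
  have "(deviate z i has_derivative deviate 0 i) (at (z $ i))"
    by (subst affine) (auto intro!: derivative_eq_intros linear_imp_has_derivative[OF lin])
  from diff_chain_at[OF this f]
  have "((\<lambda>g. f i (deviate z i g)) has_derivative (\<lambda>h. deviate 0 i h \<bullet> G)) (at (z $ i))"
    by (simp add: o_def)
  moreover have "deviate 0 i h \<bullet> G = h \<bullet> (G $ i)" for h
  proof -
    have "deviate 0 i h \<bullet> G = (\<Sum>j\<in>UNIV. if j = i then h \<bullet> (G $ j) else 0)"
      unfolding inner_vec_def[of "deviate 0 i h"] by (rule sum.cong) (auto simp: deviate_def)
    then show ?thesis by simp
  qed
  ultimately have ex: "GDERIV (\<lambda>g. f i (deviate z i g)) (z $ i) :> G $ i"
    by (simp add: gderiv_def)
  have "D = G $ i" if "GDERIV (\<lambda>g. f i (deviate z i g)) (z $ i) :> D" for D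
  proof -
    have "(\<lambda>h. h \<bullet> D) = (\<lambda>h. h \<bullet> (G $ i))"
      using has_derivative_unique[OF that[unfolded gderiv_def] ex[unfolded gderiv_def]] .
    then have "\<forall>h. h \<bullet> D = h \<bullet> (G $ i)" by (simp add: fun_eq_iff)
    then show ?thesis by (simp only: vector_eq_ldot)
  qed
  with ex have "own_grad f i z = G $ i"
    unfolding own_grad_def by (rule the_equality)
  with ex show ?thesis by simp
qed

text \<open>
  The equilibrium strategy \<open>g\<close> is compared with the softmax \<open>h\<close> of the rescaled gradient along the
  segment from \<open>g\<close> to \<open>h\<close>.  The slope of the smooth cost at \<open>g\<close> is a limit, whereas the entropy
  increments need only concavity, so that no derivative of the entropy is taken and \<open>g\<close> may lie
  on the boundary of the simplex.  The resulting inequality reads \<open>KL g h \<le> 0\<close>.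
\<close>
lemma reg_nash_softmax:
  fixes f :: "'p::finite \<Rightarrow> real^'n::finite^'p \<Rightarrow> real"
  assumes costs: "smooth_costs f" and tau: "\<tau> > 0" and nash: "reg_nash f \<tau> z"
  shows "z $ i = softmax (- (1 / \<tau>) *\<^sub>R own_grad f i z)"
proof -
  define D where "D = own_grad f i z"
  define \<theta> where "\<theta> = - (1 / \<tau>) *\<^sub>R D"
  define g where "g = z $ i"
  define h where "h = softmax \<theta>"
  define \<phi> where "\<phi> s = f i (deviate z i (g + s *\<^sub>R (h - g)))" for s
  have z: "z \<in> profiles" using nash by (simp add: reg_nash_def)
  have g: "g \<in> simplex_set" using z by (simp add: profiles_def g_def)
  have h: "h \<in> simplex_set" and hpos: "\<And>a. 0 < h $ a"
    by (simp_all add: h_def softmax_in_simplex softmax_pos)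
  have dev: "deviate z i g = z" by (simp add: deviate_def vec_eq_iff g_def)
  have "((\<lambda>s. g + s *\<^sub>R (h - g)) has_derivative (\<lambda>s. s *\<^sub>R (h - g))) (at 0)"
    by (auto intro!: derivative_eq_intros)
  moreover have "((\<lambda>g. f i (deviate z i g)) has_derivative (\<lambda>x. x \<bullet> D))
      (at (g + 0 *\<^sub>R (h - g)))"
    using GDERIV_own_grad[OF costs z, of i] by (simp add: gderiv_def D_def g_def)
  ultimately have "(\<phi> has_derivative (\<lambda>s. (s *\<^sub>R (h - g)) \<bullet> D)) (at 0)"
    using diff_chain_at by (fastforce simp: o_def \<phi>_def[abs_def])
  then have "(\<phi> has_real_derivative (h - g) \<bullet> D) (at 0)"
    by (simp add: has_field_derivative_def mult_commute_abs)
  then have "((\<lambda>s. (\<phi> s - \<phi> 0) / s) \<longlongrightarrow> (h - g) \<bullet> D) (at_right 0)"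
    by (simp add: has_field_derivative_iff filterlim_at_split)
  moreover have "eventually (\<lambda>s. \<tau> * (shannon_entropy h - shannon_entropy g) \<le> (\<phi> s - \<phi> 0) / s)
      (at_right 0)"
    unfolding eventually_at_right_field
  proof (intro exI[of _ 1] conjI allI impI)
    fix s :: real assume s: "0 < s" "s < 1"
    have "g + s *\<^sub>R (h - g) \<in> simplex_set"
    proof -
      have "0 \<le> (1 - s) * g $ a + s * h $ a" for a
        using g h s by (auto simp: simplex_set_def)
      moreover have "(g + s *\<^sub>R (h - g)) $ a = (1 - s) * g $ a + s * h $ a" for a
        by (simp add: algebra_simps)
      moreover have "(\<Sum>a\<in>UNIV. (1 - s) * g $ a + s * h $ a) = 1"
        using g h by (simp add: simplex_set_def sum.distrib flip: sum_distrib_left)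
      ultimately show ?thesis unfolding simplex_set_def by simp
    qed
    then have "f i z - \<tau> * shannon_entropy (z $ i)
        \<le> f i (deviate z i (g + s *\<^sub>R (h - g))) - \<tau> * shannon_entropy (g + s *\<^sub>R (h - g))"
      using nash unfolding reg_nash_def by blast
    then have "\<tau> * (shannon_entropy (g + s *\<^sub>R (h - g)) - shannon_entropy g) \<le> \<phi> s - \<phi> 0"
      by (simp add: \<phi>_def dev algebra_simps flip: g_def)
    moreover have "\<tau> * (s * (shannon_entropy h - shannon_entropy g))
        \<le> \<tau> * (shannon_entropy (g + s *\<^sub>R (h - g)) - shannon_entropy g)"
      using shannon_entropy_concave[OF g h hpos s] tau
      by (intro mult_left_mono) (auto simp: algebra_simps)
    ultimately have "\<tau> * (shannon_entropy h - shannon_entropy g) * s \<le> \<phi> s - \<phi> 0"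
      by (simp only: mult_ac)
    then show "\<tau> * (shannon_entropy h - shannon_entropy g) \<le> (\<phi> s - \<phi> 0) / s"
      by (simp only: pos_le_divide_eq[OF s(1)])
  qed simp
  ultimately have "\<tau> * (shannon_entropy h - shannon_entropy g) \<le> (h - g) \<bullet> D"
    by (rule tendsto_lowerbound) simp
  also have "\<dots> = \<tau> * ((g - h) \<bullet> \<theta>)"
    using tau by (simp add: \<theta>_def inner_diff_left algebra_simps)
  finally have "shannon_entropy h - shannon_entropy g \<le> (g - h) \<bullet> \<theta>"
    using tau by simp
  moreover have "KL h h = 0"
    using hpos by (simp add: KL_def less_imp_neq[symmetric])
  ultimately have "KL g h \<le> 0"
    using KL_softmax[OF g, of \<theta>] KL_softmax[OF h, of \<theta>]
    by (simp add: inner_diff_left flip: h_def)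
  then have "(norm (g - h))\<^sup>2 \<le> 0" using KL_ge_norm[OF g h hpos] by linarith
  then show ?thesis by (simp add: g_def h_def \<theta>_def D_def)
qed

section \<open>One optimistic step\<close>

text \<open>
  Split \<open>w' - w\<close> at \<open>z\<close> and apply Young's inequality to each part.  Both error terms of the analysis
  have this shape, with \<open>w'\<close> the midpoint reached from \<open>z\<close>, \<open>w\<close> the preceding midpoint, and \<open>x - y\<close>
  a difference that is itself controlled by a divergence.
\<close>
lemma lipschitz_error:
  fixes F :: "'e::real_inner \<Rightarrow> 'e"
  assumes lip: "L-lipschitz_on S F" and "w \<in> S" "w' \<in> S" "0 \<le> \<eta>"
  shows "(x - y) \<bullet> (\<eta> *\<^sub>R (F w' - F w))
    \<le> \<eta> * L * ((norm (w' - z))\<^sup>2 / 2 + (norm (z - w))\<^sup>2 / 2 + (norm (x - y))\<^sup>2)"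
proof -
  have L: "0 \<le> L" using lip by (rule lipschitz_on_nonneg)
  have F: "norm (F w' - F w) \<le> L * norm (w' - w)"
    using lipschitz_onD[OF lip assms(3,2)] by (simp add: dist_norm)
  have "norm (w' - w) \<le> norm (w' - z) + norm (z - w)"
    using norm_triangle_ineq[of "w' - z" "z - w"] by simp
  then have "norm (w' - w) * norm (x - y) \<le> (norm (w' - z) + norm (z - w)) * norm (x - y)"
    by (rule mult_right_mono) simp
  also have "\<dots> \<le> (norm (w' - z))\<^sup>2 / 2 + (norm (z - w))\<^sup>2 / 2 + (norm (x - y))\<^sup>2"
    using zero_le_power2[of "norm (w' - z) - norm (x - y)"]
      zero_le_power2[of "norm (z - w) - norm (x - y)"]
    by (simp add: power2_eq_square algebra_simps)
  finally have young: "norm (w' - w) * norm (x - y)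
      \<le> (norm (w' - z))\<^sup>2 / 2 + (norm (z - w))\<^sup>2 / 2 + (norm (x - y))\<^sup>2" .
  have "(x - y) \<bullet> (F w' - F w) \<le> norm (x - y) * (L * norm (w' - w))"
    using norm_cauchy_schwarz[of "x - y" "F w' - F w"] mult_left_mono[OF F, of "norm (x - y)"]
    by simp
  also have "\<dots> \<le> L * ((norm (w' - z))\<^sup>2 / 2 + (norm (z - w))\<^sup>2 / 2 + (norm (x - y))\<^sup>2)"
    using mult_left_mono[OF young L] by (simp add: algebra_simps)
  finally show ?thesis
    using mult_left_mono[OF _ \<open>0 \<le> \<eta>\<close>] by (fastforce simp: algebra_simps)
qed

text \<open>
  Here \<open>\<alpha>, \<omega>\<close> are the current parameters of the iterate and of the midpoint, and \<open>\<alpha>', \<omega>'\<close> the next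
  ones.  Since \<open>\<alpha>' - (1 - \<eta>\<tau>)\<alpha> - \<eta>\<tau> \<theta>s\<close> is \<open>-\<eta>\<close> times a difference of values of \<open>F\<close>, its inner
  product with \<open>\<sigma>(\<omega>') - \<sigma>(\<theta>s)\<close>, where \<open>\<sigma>\<close> is the softmax, is nonpositive by monotonicity;
  expanding it in divergences gives the recursion.
\<close>
lemma optimistic_step:
  fixes F :: "real^'n::finite^'p::finite \<Rightarrow> real^'n^'p"
  assumes mono: "monotone_operator_on profiles F"
    and lip: "L-lipschitz_on profiles F"
    and eta: "0 \<le> \<eta>" and tau: "0 \<le> \<tau>"
    and fixpoint: "\<theta>s = (1 - \<eta> * \<tau>) *\<^sub>R \<theta>s - \<eta> *\<^sub>R F (softmax_profile \<theta>s)"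
    and mid: "\<omega>' = (1 - \<eta> * \<tau>) *\<^sub>R \<alpha> - \<eta> *\<^sub>R F (softmax_profile \<omega>)"
    and step: "\<alpha>' = (1 - \<eta> * \<tau>) *\<^sub>R \<alpha> - \<eta> *\<^sub>R F (softmax_profile \<omega>')"
  shows "KL_profile (softmax_profile \<theta>s) (softmax_profile \<alpha>')
      + (1 - 2 * (\<eta> * L)) * KL_profile (softmax_profile \<alpha>') (softmax_profile \<omega>')
      + (1 - \<eta> * \<tau> - \<eta> * L) * KL_profile (softmax_profile \<omega>') (softmax_profile \<alpha>)
    \<le> (1 - \<eta> * \<tau>) * KL_profile (softmax_profile \<theta>s) (softmax_profile \<alpha>)
      + \<eta> * L * KL_profile (softmax_profile \<alpha>) (softmax_profile \<omega>)"
proof -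
  let ?s = "softmax_profile :: real^'n^'p \<Rightarrow> real^'n^'p"
  let ?K = "\<lambda>\<beta> \<gamma>. KL_profile (?s \<beta>) (?s \<gamma>)"
  define q where "q = \<eta> * \<tau>"
  have L: "0 \<le> L" using lip by (rule lipschitz_on_nonneg)
  have "0 \<le> (F (?s \<omega>') - F (?s \<theta>s)) \<bullet> (?s \<omega>' - ?s \<theta>s)"
    using mono softmax_profile_in_profiles unfolding monotone_operator_on_def by blast
  then have "0 \<le> \<eta> * ((F (?s \<omega>') - F (?s \<theta>s)) \<bullet> (?s \<omega>' - ?s \<theta>s))"
    using eta by simp
  moreover have "\<alpha>' - (1 - q) *\<^sub>R \<alpha> - q *\<^sub>R \<theta>s = - \<eta> *\<^sub>R (F (?s \<omega>') - F (?s \<theta>s))"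
  proof -
    have "q *\<^sub>R \<theta>s = - \<eta> *\<^sub>R F (?s \<theta>s)"
      using fixpoint unfolding q_def[symmetric]
      by (simp add: scaleR_left_diff_distrib minus_equation_iff[of "q *\<^sub>R \<theta>s"])
    then show ?thesis by (simp add: step q_def algebra_simps)
  qed
  ultimately have descent: "(?s \<omega>' - ?s \<theta>s) \<bullet> (\<alpha>' - (1 - q) *\<^sub>R \<alpha> - q *\<^sub>R \<theta>s) \<le> 0"
    by (simp add: inner_commute)
  have expand: "?K \<theta>s \<alpha>' - (1 - q) * ?K \<theta>s \<alpha> - q * ?K \<theta>s \<theta>s
      = ?K \<omega>' \<alpha>' - (1 - q) * ?K \<omega>' \<alpha> - q * ?K \<omega>' \<theta>s
        + (?s \<omega>' - ?s \<theta>s) \<bullet> (\<alpha>' - (1 - q) *\<^sub>R \<alpha> - q *\<^sub>R \<theta>s)"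
    unfolding KL_profile_softmax[OF softmax_profile_in_profiles]
    by (simp add: inner_diff_left inner_diff_right algebra_simps)
  have "0 \<le> q * ?K \<omega>' \<theta>s"
    using eta tau by (simp add: q_def KL_profile_nonneg softmax_profile_in_profiles)
  then have "?K \<theta>s \<alpha>' \<le> (1 - q) * ?K \<theta>s \<alpha> + ?K \<omega>' \<alpha>' - (1 - q) * ?K \<omega>' \<alpha>"
    using expand descent by (simp add: KL_profile_self)
  \<comment> \<open>Symmetrizing the divergence at \<open>\<omega>'\<close> leaves the pairing of two consecutive gradients.\<close>
  moreover have "?K \<omega>' \<alpha>' = (?s \<omega>' - ?s \<alpha>') \<bullet> (\<eta> *\<^sub>R (F (?s \<omega>') - F (?s \<omega>))) - ?K \<alpha>' \<omega>'"
  proof -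
    have "\<omega>' - \<alpha>' = \<eta> *\<^sub>R (F (?s \<omega>') - F (?s \<omega>))"
      by (simp add: mid[symmetric] step scaleR_diff_right) (simp add: mid)
    moreover have "0 = ?K \<alpha>' \<omega>' + ?K \<omega>' \<alpha>' + (?s \<alpha>' - ?s \<omega>') \<bullet> (\<omega>' - \<alpha>')"
      using KL_three_point[OF softmax_profile_in_profiles, of \<alpha>' \<alpha>' \<omega>']
      by (simp only: KL_profile_self)
    ultimately show ?thesis by (simp only: inner_diff_left)
  qed
  moreover have "(?s \<omega>' - ?s \<alpha>') \<bullet> (\<eta> *\<^sub>R (F (?s \<omega>') - F (?s \<omega>)))
      \<le> \<eta> * L * (?K \<omega>' \<alpha> + ?K \<alpha> \<omega> + 2 * ?K \<alpha>' \<omega>')"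
  proof -
    have "(norm (?s \<omega>' - ?s \<alpha>))\<^sup>2 / 2 + (norm (?s \<alpha> - ?s \<omega>))\<^sup>2 / 2 + (norm (?s \<omega>' - ?s \<alpha>'))\<^sup>2
        \<le> ?K \<omega>' \<alpha> + ?K \<alpha> \<omega> + 2 * ?K \<alpha>' \<omega>'"
      using KL_profile_ge_norm[OF softmax_profile_in_profiles, of \<omega>' \<alpha>]
        KL_profile_ge_norm[OF softmax_profile_in_profiles, of \<alpha> \<omega>]
        KL_profile_ge_norm[OF softmax_profile_in_profiles, of \<alpha>' \<omega>']
        norm_minus_commute[of "?s \<omega>'" "?s \<alpha>'"] by simp
    from mult_left_mono[OF this, of "\<eta> * L"]
    show ?thesis
      using lipschitz_error[OF lip softmax_profile_in_profiles softmax_profile_in_profiles eta,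
          of "?s \<omega>'" "?s \<alpha>'" \<omega>' \<omega> "?s \<alpha>"] eta L by simp
  qed
  ultimately show ?thesis unfolding q_def by (simp add: algebra_simps)
qed

text \<open>
  \<open>\<omega>'\<close> and \<open>\<alpha>'\<close> differ only in the gradient that is used, so the three-point identity costs one
  more error term of the kind treated before.
\<close>
lemma optimistic_midpoint:
  fixes F :: "real^'n::finite^'p::finite \<Rightarrow> real^'n^'p"
  assumes lip: "L-lipschitz_on profiles F" and eta: "0 \<le> \<eta>" and z: "z \<in> profiles"
    and mid: "\<omega>' = \<gamma> - \<eta> *\<^sub>R F (softmax_profile \<omega>)"
    and step: "\<alpha>' = \<gamma> - \<eta> *\<^sub>R F (softmax_profile \<omega>')"
  shows "KL_profile z (softmax_profile \<omega>')
    \<le> (1 + 2 * (\<eta> * L)) * KL_profile z (softmax_profile \<alpha>')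
      + KL_profile (softmax_profile \<alpha>') (softmax_profile \<omega>')
      + \<eta> * L * (KL_profile (softmax_profile \<omega>') (softmax_profile \<alpha>)
        + KL_profile (softmax_profile \<alpha>) (softmax_profile \<omega>))"
proof -
  let ?s = "softmax_profile :: real^'n^'p \<Rightarrow> real^'n^'p"
  let ?K = "\<lambda>\<beta> \<gamma>. KL_profile (?s \<beta>) (?s \<gamma>)"
  have L: "0 \<le> L" using lip by (rule lipschitz_on_nonneg)
  have "\<alpha>' - \<omega>' = - \<eta> *\<^sub>R (F (?s \<omega>') - F (?s \<omega>))"
    by (simp add: mid[symmetric] step scaleR_diff_right) (simp add: mid)
  then have "(z - ?s \<alpha>') \<bullet> (\<alpha>' - \<omega>') = (?s \<alpha>' - z) \<bullet> (\<eta> *\<^sub>R (F (?s \<omega>') - F (?s \<omega>)))"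
    by (simp only: inner_simps) (simp add: algebra_simps)
  moreover have "(?s \<alpha>' - z) \<bullet> (\<eta> *\<^sub>R (F (?s \<omega>') - F (?s \<omega>)))
      \<le> \<eta> * L * (?K \<omega>' \<alpha> + ?K \<alpha> \<omega> + 2 * KL_profile z (?s \<alpha>'))"
  proof -
    have "(norm (?s \<omega>' - ?s \<alpha>))\<^sup>2 / 2 + (norm (?s \<alpha> - ?s \<omega>))\<^sup>2 / 2 + (norm (?s \<alpha>' - z))\<^sup>2
        \<le> ?K \<omega>' \<alpha> + ?K \<alpha> \<omega> + 2 * KL_profile z (?s \<alpha>')"
      using KL_profile_ge_norm[OF softmax_profile_in_profiles, of \<omega>' \<alpha>]
        KL_profile_ge_norm[OF softmax_profile_in_profiles, of \<alpha> \<omega>]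
        KL_profile_ge_norm[OF z, of \<alpha>'] norm_minus_commute[of z "?s \<alpha>'"] by simp
    from mult_left_mono[OF this, of "\<eta> * L"]
    show ?thesis
      using lipschitz_error[OF lip softmax_profile_in_profiles softmax_profile_in_profiles eta,
          of "?s \<alpha>'" z \<omega>' \<omega> "?s \<alpha>"] eta L by simp
  qed
  ultimately show ?thesis
    using KL_three_point[OF z, of \<omega>' \<alpha>'] by (simp add: algebra_simps)
qed

section \<open>Convergence\<close>

text \<open>
  The shift by \<open>(2C/q)(1 - q)\<^sup>t\<close> absorbs the inhomogeneous term: the shifted sequence contracts by
  the factor \<open>1 - q/2\<close>, since \<open>C + (2C/q)(1 - q) = (1 - q/2)(2C/q)\<close>, and \<open>1 - q + q\<^sup>2 \<le> 1 - q/2\<close>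
  for \<open>q \<le> 1/2\<close>.
\<close>
lemma perturbed_contraction:
  fixes E :: "nat \<Rightarrow> real"
  assumes q: "0 < q" "q \<le> 1 / 2" and E: "\<And>t. 0 \<le> E t"
    and rec: "\<And>t. E (Suc t) \<le> (1 - q + q\<^sup>2) * E t + (1 - q) ^ t * C"
  shows "E t + 2 * C / q * (1 - q) ^ t \<le> (1 - q / 2) ^ t * (E 0 + 2 * C / q)"
proof (induction t)
  case (Suc t)
  have "1 - q + q\<^sup>2 \<le> 1 - q / 2"
    using mult_right_mono[OF q(2), of q] q by (simp add: power2_eq_square field_simps)
  then have "(1 - q + q\<^sup>2) * E t \<le> (1 - q / 2) * E t"
    using E by (rule mult_right_mono)
  then have "E (Suc t) + 2 * C / q * (1 - q) ^ Suc t
      \<le> (1 - q / 2) * E t + (1 - q) ^ t * C + 2 * C / q * (1 - q) ^ Suc t"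
    using rec[of t] by simp
  also have "\<dots> = (1 - q / 2) * (E t + 2 * C / q * (1 - q) ^ t)"
    using q by (simp add: field_simps)
  also have "\<dots> \<le> (1 - q / 2) * ((1 - q / 2) ^ t * (E 0 + 2 * C / q))"
    using Suc.IH q by (intro mult_left_mono) auto
  finally show ?case by (simp add: mult.assoc)
qed simp

text \<open>
  Young's inequality with the weight that turns the coefficient of \<open>(norm x)\<^sup>2\<close> into
  \<open>(1 - q)\<^sup>2 + q\<close>; the gap between the two sides is exactly \<open>(norm (q x + (1 - q) y))\<^sup>2 / q\<close>.
\<close>
lemma weighted_young:
  fixes x y :: "'e::real_inner"
  assumes "0 < q"
  shows "(norm ((1 - q) *\<^sub>R x - y))\<^sup>2
    \<le> (1 - q + q\<^sup>2) * (norm x)\<^sup>2 + (1 + 1 / q * (1 - q)\<^sup>2) * (norm y)\<^sup>2"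
proof -
  have "0 \<le> (norm (q *\<^sub>R x + (1 - q) *\<^sub>R y))\<^sup>2 / q" using assms by simp
  also have "\<dots> = (1 - q + q\<^sup>2) * (norm x)\<^sup>2 + (1 + 1 / q * (1 - q)\<^sup>2) * (norm y)\<^sup>2
      - (norm ((1 - q) *\<^sub>R x - y))\<^sup>2"
    unfolding power2_norm_eq_inner using assms
    by (simp add: inner_simps inner_commute[of y x] field_simps power2_eq_square)
  finally show ?thesis by simp
qed

theorem theorem5p3:
  fixes f :: "'p::finite \<Rightarrow> real^'n::finite^'p \<Rightarrow> real"
    and L \<tau> \<eta> C V0 :: real
    and zstar \<theta>star :: "real^'n^'p"
    and \<theta> \<theta>bar z zbar :: "nat \<Rightarrow> real^'n^'p"
  assumes costs: "smooth_costs f"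
    and mono: "monotone_operator_on profiles (pseudo_gradient f)"
    and L_pos: "L > 0"
    and lip: "L-lipschitz_on profiles (pseudo_gradient f)"
    and tau_pos: "\<tau> > 0"
    and nash: "reg_nash f \<tau> zstar"
    and eta_pos: "0 < \<eta>"
    and eta_less: "\<eta> < 1 / (2 * (real CARD('p) + 4) * L + 2 * \<tau>)"
    and theta_0: "\<And>i. \<theta> 0 $ i = 0"
    and thetabar_0: "\<And>i. \<theta>bar 0 $ i = 0"
    and z_def: "\<And>t. z t = softmax_profile (\<theta> t)"
    and zbar_def: "\<And>t. zbar t = softmax_profile (\<theta>bar t)"
    and thetabar_Suc: "\<And>t i. \<theta>bar (Suc t) $ i
          = (1 - \<eta> * \<tau>) *\<^sub>R \<theta> t $ i - \<eta> *\<^sub>R own_grad f i (zbar t)"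
    and theta_Suc: "\<And>t i. \<theta> (Suc t) $ i
          = (1 - \<eta> * \<tau>) *\<^sub>R \<theta> t $ i - \<eta> *\<^sub>R own_grad f i (zbar (Suc t))"
    and thetastar_def: "\<And>i. \<theta>star $ i = - (1 / \<tau>) *\<^sub>R own_grad f i zstar"
    and C_def: "C = 4 * \<eta>\<^sup>2 * L\<^sup>2 * (1 + 1 / (\<eta> * \<tau>) * (1 - \<eta> * \<tau>)\<^sup>2) * KL_profile zstar (z 0)"
    and V0_def: "V0 = (norm (\<theta> 0 - \<theta>star))\<^sup>2 + 2 * real CARD('p) * C / (\<eta> * \<tau>)"
  shows "\<forall>t. max (KL_profile zstar (z t)) (KL_profile zstar (zbar (Suc t)))
               \<le> (1 - \<eta> * \<tau>) ^ t * 2 * KL_profile zstar (z 0)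
           \<and> (norm (\<theta> (Suc t) - \<theta>star))\<^sup>2 \<le> (1 - \<eta> * \<tau> / 2) ^ t * V0"
proof -
  define F where "F = pseudo_gradient f"
  define q where "q = \<eta> * \<tau>"
  define u where "u = \<eta> * L"
  define K where "K t = KL_profile zstar (z t)" for t
  define D where "D t = KL_profile (z t) (zbar t)" for t
  define E where "E t = (norm (\<theta> t - \<theta>star))\<^sup>2" for t
  have own: "own_grad f i x = F x $ i" for i x by (simp add: F_def pseudo_gradient_def)
  have N: "1 \<le> real CARD('p)" by (simp add: Suc_le_eq)
  have small: "10 * u + 2 * q < 1"
  proof -
    have "10 * L \<le> 2 * (real CARD('p) + 4) * L"
      using N L_pos by (intro mult_right_mono) auto
    moreover have "0 < 2 * (real CARD('p) + 4) * L + 2 * \<tau>"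
      using L_pos tau_pos by (intro add_pos_pos) auto
    moreover have "\<eta> * (2 * (real CARD('p) + 4) * L + 2 * \<tau>) < 1"
      using eta_less calculation(2) by (simp add: pos_less_divide_eq)
    moreover have "\<eta> * (10 * L + 2 * \<tau>) \<le> \<eta> * (2 * (real CARD('p) + 4) * L + 2 * \<tau>)"
      using calculation(1) eta_pos by (intro mult_left_mono) auto
    ultimately show ?thesis by (simp add: u_def q_def algebra_simps)
  qed
  have u: "0 < u" and q: "0 < q" using eta_pos L_pos tau_pos by (simp_all add: u_def q_def)
  have u': "u < 1 / 10" and q': "q < 1 / 2" using small u q by auto
  have zs: "zstar \<in> profiles" using nash by (simp add: reg_nash_def)
  have zstar: "zstar = softmax_profile \<theta>star"
    using reg_nash_softmax[OF costs tau_pos nash]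
    by (simp add: softmax_profile_def vec_eq_iff[of zstar] thetastar_def)
  have mid: "\<theta>bar (Suc t) = (1 - q) *\<^sub>R \<theta> t - \<eta> *\<^sub>R F (zbar t)" for t
    by (simp add: vec_eq_iff[of "\<theta>bar (Suc t)"] thetabar_Suc own q_def)
  have step: "\<theta> (Suc t) = (1 - q) *\<^sub>R \<theta> t - \<eta> *\<^sub>R F (zbar (Suc t))" for t
    by (simp add: vec_eq_iff[of "\<theta> (Suc t)"] theta_Suc own q_def)
  have "\<tau> *\<^sub>R \<theta>star = - F zstar"
    using tau_pos by (simp add: vec_eq_iff[of "\<tau> *\<^sub>R \<theta>star"] thetastar_def own)
  then have fixpoint: "\<theta>star = (1 - q) *\<^sub>R \<theta>star - \<eta> *\<^sub>R F zstar"
    by (simp add: q_def scaleR_left_diff_distrib flip: scaleR_scaleR)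
  have K0: "0 \<le> K t" and D0: "0 \<le> D t" for t
    by (simp_all add: K_def D_def z_def zbar_def KL_profile_nonneg softmax_profile_in_profiles zs)
  have A0: "0 \<le> KL_profile (zbar (Suc t)) (z t)" for t
    by (simp add: z_def zbar_def KL_profile_nonneg softmax_profile_in_profiles)
  have main: "K (Suc t) + (1 - 2 * u) * D (Suc t)
      + (1 - q - u) * KL_profile (zbar (Suc t)) (z t) \<le> (1 - q) * K t + u * D t" for t
    unfolding K_def D_def u_def q_def z_def zbar_def zstar
    using mono lip eta_pos tau_pos fixpoint mid[of t] step[of t]
    unfolding F_def[symmetric] q_def zstar zbar_def
    by (intro optimistic_step[where F = F]) simp_all
  have midpoint: "KL_profile zstar (zbar (Suc t)) \<le> (1 + 2 * u) * K (Suc t) + D (Suc t)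
      + u * (KL_profile (zbar (Suc t)) (z t) + D t)" for t
    unfolding K_def D_def u_def z_def zbar_def
    using lip eta_pos zs mid[of t] step[of t]
    unfolding F_def[symmetric] zbar_def
    by (intro optimistic_midpoint[where F = F and \<gamma> = "(1 - q) *\<^sub>R \<theta> t"]) simp_all
  have potential: "K t + (1 - 2 * u) * D t \<le> (1 - q) ^ t * K 0" for t
  proof (induction t)
    case 0
    have "\<theta> 0 = \<theta>bar 0" by (simp add: vec_eq_iff[of "\<theta> 0"] theta_0 thetabar_0)
    then have "D 0 = 0" by (simp add: D_def z_def zbar_def KL_profile_self)
    then show ?case by simp
  next
    case (Suc t)
    have "(1 / 2) * (4 / 5) \<le> (1 - q) * (1 - 2 * u)"
      using q' u' by (intro mult_mono) auto
    then have "u * D t \<le> ((1 - q) * (1 - 2 * u)) * D t"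
      using D0[of t] u' by (intro mult_right_mono) auto
    moreover have "0 \<le> (1 - q - u) * KL_profile (zbar (Suc t)) (z t)"
      using A0[of t] u' q' by (intro mult_nonneg_nonneg) auto
    ultimately have "K (Suc t) + (1 - 2 * u) * D (Suc t) \<le> (1 - q) * (K t + (1 - 2 * u) * D t)"
      using main[of t] by (simp add: algebra_simps)
    also have "\<dots> \<le> (1 - q) * ((1 - q) ^ t * K 0)"
      using Suc.IH q' by (intro mult_left_mono) auto
    finally show ?case by (simp add: mult.assoc)
  qed
  have z_bound: "K t \<le> (1 - q) ^ t * 2 * K 0" for t
  proof -
    have "0 \<le> (1 - 2 * u) * D t" using D0[of t] u' by simp
    moreover have "0 \<le> (1 - q) ^ t * K 0" using K0 q' by simp
    ultimately show ?thesis using potential[of t] by simp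
  qed
  have zbar_bound: "KL_profile zstar (zbar (Suc t)) \<le> (1 - q) ^ t * 2 * K 0" for t
  proof -
    let ?A = "KL_profile (zbar (Suc t)) (z t)"
    \<comment> \<open>For \<open>u < 1/10\<close> and \<open>q < 1/2\<close>, twice the left-hand side of \<open>main\<close> dominates the bound in
      \<open>midpoint\<close> term by term, and twice its right-hand side is below twice the potential even
      after adding the leftover \<open>u * D t\<close>.\<close>
    have "(1 + 2 * u) * K (Suc t) \<le> 2 * K (Suc t)"
      using u' K0 by (intro mult_right_mono) auto
    moreover have "1 * D (Suc t) \<le> (2 * (1 - 2 * u)) * D (Suc t)"
      using u' D0 by (intro mult_right_mono) auto
    moreover have "u * ?A \<le> (2 * (1 - q - u)) * ?A"
      using u' q' A0 by (intro mult_right_mono) auto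
    moreover have "(3 * u) * D t \<le> (2 * (1 - 2 * u)) * D t"
      using u' D0 by (intro mult_right_mono) auto
    moreover have "(1 - q) * K t \<le> 1 * K t"
      using q K0 by (intro mult_right_mono) auto
    ultimately have "KL_profile zstar (zbar (Suc t)) \<le> 2 * (K t + (1 - 2 * u) * D t)"
      using main[of t] midpoint[of t] by (simp add: algebra_simps)
    then show ?thesis using potential[of t] by simp
  qed
  have C: "C = 4 * u\<^sup>2 * (1 + 1 / q * (1 - q)\<^sup>2) * K 0"
    by (simp add: C_def u_def q_def K_def power_mult_distrib)
  have C0: "0 \<le> C" unfolding C using K0 q by simp
  have "E (Suc t) \<le> (1 - q + q\<^sup>2) * E t + (1 - q) ^ t * C" for t
  proof -
    have "\<theta> (Suc t) - \<theta>star = (1 - q) *\<^sub>R (\<theta> t - \<theta>star) - \<eta> *\<^sub>R (F (zbar (Suc t)) - F zstar)"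
      by (subst fixpoint, subst step) (simp add: algebra_simps)
    then have "E (Suc t) \<le> (1 - q + q\<^sup>2) * E t
        + (1 + 1 / q * (1 - q)\<^sup>2) * (norm (\<eta> *\<^sub>R (F (zbar (Suc t)) - F zstar)))\<^sup>2"
      unfolding E_def using weighted_young[OF q] by metis
    moreover have "(norm (\<eta> *\<^sub>R (F (zbar (Suc t)) - F zstar)))\<^sup>2 \<le> 4 * u\<^sup>2 * ((1 - q) ^ t * K 0)"
    proof -
      have "norm (F (zbar (Suc t)) - F zstar) \<le> L * norm (zbar (Suc t) - zstar)"
        using lipschitz_onD[OF lip, of "zbar (Suc t)" zstar] zs
        by (simp add: F_def dist_norm zbar_def softmax_profile_in_profiles)
      then have "norm (\<eta> *\<^sub>R (F (zbar (Suc t)) - F zstar)) \<le> u * norm (zbar (Suc t) - zstar)"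
        using eta_pos by (simp add: u_def mult.assoc)
      then have "(norm (\<eta> *\<^sub>R (F (zbar (Suc t)) - F zstar)))\<^sup>2
          \<le> (u * norm (zbar (Suc t) - zstar))\<^sup>2"
        by (rule power_mono) simp
      also have "\<dots> = u\<^sup>2 * (norm (zstar - zbar (Suc t)))\<^sup>2"
        by (simp add: power_mult_distrib norm_minus_commute)
      also have "\<dots> \<le> u\<^sup>2 * (4 * ((1 - q) ^ t * K 0))"
      proof (rule mult_left_mono)
        show "(norm (zstar - zbar (Suc t)))\<^sup>2 \<le> 4 * ((1 - q) ^ t * K 0)"
          using KL_profile_ge_norm[OF zs, of "\<theta>bar (Suc t)"] zbar_bound[of t]
          by (simp add: zbar_def)
      qed simp
      finally show ?thesis by simp
    qed
    ultimately show ?thesis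
      using mult_left_mono[of "(norm (\<eta> *\<^sub>R (F (zbar (Suc t)) - F zstar)))\<^sup>2"
          "4 * u\<^sup>2 * ((1 - q) ^ t * K 0)" "1 + 1 / q * (1 - q)\<^sup>2"] q
      unfolding C by (simp add: mult_ac)
  qed
  then have contraction: "E t + 2 * C / q * (1 - q) ^ t \<le> (1 - q / 2) ^ t * (E 0 + 2 * C / q)" for t
    using q q' by (intro perturbed_contraction) (auto simp: E_def)
  have theta_bound: "E (Suc t) \<le> (1 - q / 2) ^ t * V0" for t
  proof -
    have "2 * C * 1 \<le> 2 * C * real CARD('p)" using C0 N by (intro mult_left_mono) auto
    then have "2 * C / q \<le> 2 * real CARD('p) * C / q"
      using q by (simp add: divide_right_mono mult_ac)
    then have W: "E 0 + 2 * C / q \<le> V0" by (simp add: V0_def E_def q_def)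
    have W0: "0 \<le> E 0 + 2 * C / q" using C0 q by (simp add: E_def)
    have "0 \<le> 2 * C / q * (1 - q) ^ Suc t" using C0 q q' by simp
    then have "E (Suc t) \<le> (1 - q / 2) ^ Suc t * (E 0 + 2 * C / q)"
      using contraction[of "Suc t"] by linarith
    also have "\<dots> \<le> (1 - q / 2) ^ t * V0"
      using W W0 q q' by (intro mult_mono power_decreasing) auto
    finally show ?thesis .
  qed
  show ?thesis
    using z_bound zbar_bound theta_bound by (simp add: K_def E_def q_def)
qed

end
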